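(* Let $\overline{n}=(n_1,\dots,n_t)\in\mathbb{N}_{>0}^t$ and $\overline{m}=(m_1,\dots,m_t)\in\mathbb{N}^t$ uniquely characterize a simple game $v$ with minimum. If $v$ contains neither null players nor veto players, then $\dim(v)=t$.
   Context: A simple game is a pair $(N,v)$ with $N$ a finite nonempty set of players and $v:2^N\to\{0,1\}$ satisfying $v(\emptyset)=0$, $v(N)=1$ and $v(S)\le v(T)$ whenever $S\subseteq T$. A coalition $S$ is winning if $v(S)=1$ and losing otherwise; it is minimal winning if it is winning and all its proper subsets are losing. $\mathbb N$ includes $0$. Players $a,b$ are equivalent (equi-desirable) if the transposition of $a$ and $b$ preserves the set of winning coalitions; let $N_1,\dots,N_t$ be the equivalence classes. To a coalition $S$ associate the vector $(|S\cap N_1|,\dots,|S\cap N_t|)$. The vectors of minimal winning coalitions are called minimal winning vectors. A simple game with minimum is a simple game with exactly one minimal winning vector. That $(\overline n,\overline m)$ uniquely characterizes the simple game $v$ with minimum means: $v$ has exactly the $t$ equivalence classes $N_1,\dots,N_t$ with $|N_i|=n_i$, and its unique minimal winning vector is $\overline m$; so $S$ is winning iff $|S\cap N_i|\ge m_i$ for all $i$. A player is null if it belongs to no minimal winning coalition (the players of $N_i$ are null iff $m_i=0$), and veto if it belongs to every winning coalition (the players of $N_i$ are veto iff $m_i=n_i$). A simple game $(N,v)$ is weighted if there are weights $w_i\in\mathbb R$ ($i\in N$) and a quota $q\in\mathbb R$ with $\sum_{i\in W}w_i\ge q>\sum_{i\in L}w_i$ for every winning coalition $W$ and every losing coalition $L$.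 The intersection of simple games on the same player set $N$ is the game in which a coalition is winning iff it is winning in each of them. The dimension $\dim(v)$ is the smallest integer $k\ge1$ such that $v$ is the intersection of $k$ weighted games on $N$. *)

theory Defs
  imports Complex_Main "HOL-Combinatorics.Transposition"
begin

text \<open>
  A game on \<open>N\<close> is given by a function on all sets, of which only the values on subsets of \<open>N\<close>
  are meaningful; hence games on \<open>N\<close> are compared on subsets of \<open>N\<close> only.
\<close>

definition simple_game :: "'a set \<Rightarrow> ('a set \<Rightarrow> nat) \<Rightarrow> bool" where
  "simple_game N v \<longleftrightarrow> finite N \<and> N \<noteq> {} \<and> (\<forall>S. S \<subseteq> N \<longrightarrow> v S \<in> {0, 1}) \<and>
     v {} = 0 \<and> v N = 1 \<and> (\<forall>S T. S \<subseteq> T \<and> T \<subseteq> N \<longrightarrow> v S \<le> v T)"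

definition winning :: "'a set \<Rightarrow> ('a set \<Rightarrow> nat) \<Rightarrow> 'a set set" where
  "winning N v = {S. S \<subseteq> N \<and> v S = 1}"

definition losing :: "'a set \<Rightarrow> ('a set \<Rightarrow> nat) \<Rightarrow> 'a set set" where
  "losing N v = {S. S \<subseteq> N \<and> v S \<noteq> 1}"

definition minimal_winning :: "'a set \<Rightarrow> ('a set \<Rightarrow> nat) \<Rightarrow> 'a set set" where
  "minimal_winning N v = {S \<in> winning N v. \<forall>T. T \<subset> S \<longrightarrow> T \<in> losing N v}"

definition equi_desirable :: "'a set \<Rightarrow> ('a set \<Rightarrow> nat) \<Rightarrow> ('a \<times> 'a) set" where
  "equi_desirable N v = {(a, b). a \<in> N \<and> b \<in> N \<and>
     (\<lambda>S. Transposition.transpose a b ` S) ` winning N v = winning N v}"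

text \<open>\<open>C\<close> lists the equivalence classes \<open>N\<^sub>1, \<dots>, N\<^sub>t\<close>, each exactly once; vectors are lists
  indexed like \<open>C\<close>, so their indices start at 0.\<close>

definition lists_classes :: "'a set \<Rightarrow> ('a set \<Rightarrow> nat) \<Rightarrow> 'a set list \<Rightarrow> bool" where
  "lists_classes N v C \<longleftrightarrow> distinct C \<and> set C = N // equi_desirable N v"

definition coalition_vector :: "'a set list \<Rightarrow> 'a set \<Rightarrow> nat list" where
  "coalition_vector C S = map (\<lambda>A. card (S \<inter> A)) C"

definition minimal_winning_vectors ::
    "'a set \<Rightarrow> ('a set \<Rightarrow> nat) \<Rightarrow> 'a set list \<Rightarrow> nat list set" where
  "minimal_winning_vectors N v C = coalition_vector C ` minimal_winning N v"

text \<open>The number of minimal winning vectors does not depend on the order in which the classes are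
  listed.\<close>

definition simple_game_with_minimum :: "'a set \<Rightarrow> ('a set \<Rightarrow> nat) \<Rightarrow> bool" where
  "simple_game_with_minimum N v \<longleftrightarrow> simple_game N v \<and>
     (\<exists>C. lists_classes N v C \<and> (\<exists>!x. x \<in> minimal_winning_vectors N v C))"

definition characterizes :: "nat list \<Rightarrow> nat list \<Rightarrow> 'a set \<Rightarrow> ('a set \<Rightarrow> nat) \<Rightarrow> bool" where
  "characterizes n m N v \<longleftrightarrow>
     (\<exists>C. lists_classes N v C \<and> map card C = n \<and> minimal_winning_vectors N v C = {m})"

definition null_player :: "'a set \<Rightarrow> ('a set \<Rightarrow> nat) \<Rightarrow> 'a \<Rightarrow> bool" where
  "null_player N v a \<longleftrightarrow> a \<in> N \<and> (\<forall>S \<in> minimal_winning N v. a \<notin> S)"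

definition veto_player :: "'a set \<Rightarrow> ('a set \<Rightarrow> nat) \<Rightarrow> 'a \<Rightarrow> bool" where
  "veto_player N v a \<longleftrightarrow> a \<in> N \<and> (\<forall>S \<in> winning N v. a \<in> S)"

definition weighted_game :: "'a set \<Rightarrow> ('a set \<Rightarrow> nat) \<Rightarrow> bool" where
  "weighted_game N v \<longleftrightarrow> simple_game N v \<and>
     (\<exists>(w :: 'a \<Rightarrow> real) (q :: real).
        (\<forall>W \<in> winning N v. sum w W \<ge> q) \<and> (\<forall>L \<in> losing N v. q > sum w L))"

definition intersection_of_weighted :: "'a set \<Rightarrow> ('a set \<Rightarrow> nat) \<Rightarrow> nat \<Rightarrow> bool" where
  "intersection_of_weighted N v k \<longleftrightarrow>
     (\<exists>g :: nat \<Rightarrow> 'a set \<Rightarrow> nat. (\<forall>i<k. weighted_game N (g i)) \<and>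
        (\<forall>S. S \<subseteq> N \<longrightarrow> (S \<in> winning N v \<longleftrightarrow> (\<forall>i<k. S \<in> winning N (g i)))))"

definition dimension :: "'a set \<Rightarrow> ('a set \<Rightarrow> nat) \<Rightarrow> nat" where
  "dimension N v = (LEAST k. k \<ge> 1 \<and> intersection_of_weighted N v k)"

end

theory Submission imports Defs begin

text \<open>
  A game with minimum is the intersection, over its equivalence classes \<open>N\<^sub>i\<close>, of the games
  ``at least \<open>m\<^sub>i\<close> players of \<open>N\<^sub>i\<close>''. This holds because a winning coalition stays winning
  when a member is exchanged for an equivalent outsider, so that only the numbers of players taken
  from each class matter (\<open>winning_of_card_le\<close>, \<open>winning_iff_thresholds\<close>). Each of these \<open>t\<close> games
  is weighted, with weight 1 on \<open>N\<^sub>i\<close> and 0 elsewhere; without null or veto players the thresholds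
  satisfy \<open>0 < m\<^sub>i < n\<^sub>i\<close>, so that in each of them the empty coalition loses and the coalition
  of all players wins. Hence the dimension is at most \<open>t\<close>.

  For the lower bound, let \<open>L\<^sub>i\<close> consist of all players except that it has only \<open>m\<^sub>i - 1\<close>
  players of \<open>N\<^sub>i\<close>. This coalition loses, so in any representation of the game as an intersection
  of weighted games one of these rejects it. With fewer than \<open>t\<close> weighted games, one of them
  rejects both \<open>L\<^sub>i\<close> and \<open>L\<^sub>j\<close> for some \<open>i \<noteq> j\<close>. Now \<open>L\<^sub>j\<close> gives a player of \<open>N\<^sub>i\<close>
  to \<open>L\<^sub>i\<close> and gets a player of \<open>N\<^sub>j\<close> in return. Both coalitions become winning, the donors
  being able to spare a player because \<open>m\<^sub>i < n\<^sub>i\<close> and \<open>m\<^sub>j < n\<^sub>j\<close>. But a trade preserves the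
  total weight of the two coalitions, so it cannot turn two losing coalitions of a weighted game
  into two winning ones (\<open>weighted_game_no_swap\<close>).
\<close>

section \<open>Equivalence classes of players\<close>

lemma equi_desirable_transpose_winning:
  assumes "(a, b) \<in> equi_desirable N v" and "S \<in> winning N v"
  shows "Transposition.transpose a b ` S \<in> winning N v"
  using assms unfolding equi_desirable_def by blast

text \<open>Transitivity holds because the transposition of \<open>a\<close> and \<open>c\<close> is the conjugate of that of
  \<open>b\<close> and \<open>c\<close> by that of \<open>a\<close> and \<open>b\<close>.\<close>

lemma equiv_equi_desirable: "equiv N (equi_desirable N v)"
proof (rule equivI)
  show "equi_desirable N v \<subseteq> N \<times> N"
    unfolding equi_desirable_def by auto
  show "refl_on N (equi_desirable N v)"
    unfolding equi_desirable_def refl_on_def by auto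
  show "sym (equi_desirable N v)"
    unfolding equi_desirable_def sym_def by (auto simp: transpose_commute)
  show "trans (equi_desirable N v)"
  proof (rule transI)
    fix a b c
    assume ab: "(a, b) \<in> equi_desirable N v" and bc: "(b, c) \<in> equi_desirable N v"
    let ?\<tau> = "\<lambda>x y S. Transposition.transpose x y ` S"
    show "(a, c) \<in> equi_desirable N v"
    proof (cases "a = b \<or> b = c \<or> a = c")
      case True
      then show ?thesis
        using ab bc unfolding equi_desirable_def by auto
    next
      case False
      have "?\<tau> a c S = ?\<tau> a b (?\<tau> b c (?\<tau> a b S))" for S
        unfolding image_image using False
        by (intro image_cong) (auto simp: transpose_def)
      then have "?\<tau> a c ` winning N v = ?\<tau> a b ` ?\<tau> b c ` ?\<tau> a b ` winning N v"
        by (simp add: image_image)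
      also have "\<dots> = winning N v"
        using ab bc unfolding equi_desirable_def by simp
      finally show ?thesis
        using ab bc unfolding equi_desirable_def by simp
    qed
  qed
qed

lemma lists_classes_partition:
  assumes "lists_classes N v C"
  shows "\<Union>(set C) = N"
    and "\<And>i. i < length C \<Longrightarrow> C ! i \<subseteq> N"
    and "\<And>i j. \<lbrakk>i < length C; j < length C; i \<noteq> j\<rbrakk> \<Longrightarrow> C ! i \<inter> C ! j = {}"
    and "\<And>i a b. \<lbrakk>i < length C; a \<in> C ! i; b \<in> C ! i\<rbrakk> \<Longrightarrow> (a, b) \<in> equi_desirable N v"
proof -
  note E = equiv_equi_desirable[of N v]
  have d: "distinct C" and s: "set C = N // equi_desirable N v"
    using assms unfolding lists_classes_def by auto
  show U: "\<Union>(set C) = N"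
    using Union_quotient[OF E] s by simp
  show "C ! i \<subseteq> N" if "i < length C" for i
    using U that by (metis Union_upper nth_mem)
  show "C ! i \<inter> C ! j = {}" if "i < length C" "j < length C" "i \<noteq> j" for i j
    using quotient_disj[OF E, of "C ! i" "C ! j"] that d s nth_mem nth_eq_iff_index_eq by metis
  show "(a, b) \<in> equi_desirable N v" if "i < length C" "a \<in> C ! i" "b \<in> C ! i" for i a b
    using quotient_eq_iff[OF E, of "C ! i" "C ! i" a b] that s nth_mem by metis
qed

section \<open>Winning coalitions of a game with minimum\<close>

lemma winning_mono:
  assumes "simple_game N v" and "S \<in> winning N v" and "S \<subseteq> T" and "T \<subseteq> N"
  shows "T \<in> winning N v"
proof -
  have "v S \<le> v T" "v T \<in> {0, 1}"
    using assms(1,3,4) unfolding simple_game_def by blast+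
  moreover have "v S = 1"
    using assms(2) unfolding winning_def by simp
  ultimately show ?thesis
    using assms(4) unfolding winning_def by auto
qed

lemma minimal_winning_subset_exists:
  assumes "finite N" and "S \<in> winning N v"
  shows "\<exists>T \<in> minimal_winning N v. T \<subseteq> S"
proof -
  have "finite (winning N v)"
    using assms(1) unfolding winning_def by simp
  then obtain T where T: "T \<in> winning N v" "T \<subseteq> S"
      and min: "\<And>U. \<lbrakk>U \<in> winning N v; U \<subseteq> T\<rbrakk> \<Longrightarrow> U = T"
    using finite_has_minimal2[OF _ assms(2)] by metis
  have "U \<in> losing N v" if "U \<subset> T" for U
    using T(1) min[of U] that unfolding winning_def losing_def by blast
  then show ?thesis
    using T unfolding minimal_winning_def by blast
qed

text \<open>A member \<open>b\<close> of the winning coalition \<open>T\<close> outside \<open>S\<close> can be replaced by an equivalent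
  player of \<open>S\<close> outside \<open>T\<close>, because \<open>S\<close> has at least as many players of the class of \<open>b\<close>.
  Each replacement brings \<open>T\<close> closer to \<open>S\<close>, until \<open>T \<subseteq> S\<close>.\<close>

lemma winning_of_card_le:
  assumes game: "simple_game N v" and C: "lists_classes N v C"
    and "T \<in> winning N v" and S: "S \<subseteq> N"
    and "\<And>i. i < length C \<Longrightarrow> card (T \<inter> C ! i) \<le> card (S \<inter> C ! i)"
  shows "S \<in> winning N v"
  using assms(3,5)
proof (induction "card (T - S)" arbitrary: T rule: less_induct)
  case less
  have fin: "finite N"
    using game unfolding simple_game_def by simp
  have TN: "T \<subseteq> N"
    using less.prems(1) unfolding winning_def by simp
  have finT: "finite T"
    using TN fin by (auto intro: finite_subset)
  note P = lists_classes_partition[OF C]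
  show ?case
  proof (cases "T \<subseteq> S")
    case True
    then show ?thesis
      using winning_mono[OF game less.prems(1)] S by blast
  next
    case False
    then obtain b where b: "b \<in> T" "b \<notin> S"
      by blast
    then obtain i where i: "i < length C" "b \<in> C ! i"
      using P(1) TN by (metis UnionE in_set_conv_nth subsetD)
    have "\<not> S \<inter> C ! i \<subseteq> T"
    proof
      assume "S \<inter> C ! i \<subseteq> T"
      then have "S \<inter> C ! i \<subset> T \<inter> C ! i"
        using b i by blast
      then have "card (S \<inter> C ! i) < card (T \<inter> C ! i)"
        using finT by (simp add: psubset_card_mono)
      then show False
        using less.prems(2)[OF i(1)] by simp
    qed
    then obtain a where a: "a \<in> S" "a \<in> C ! i" "a \<notin> T"
      by blast
    let ?\<tau> = "Transposition.transpose a b"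
    have im: "?\<tau> ` T = insert a (T - {b})"
    proof -
      have "?\<tau> ` T = insert (?\<tau> b) (?\<tau> ` (T - {b}))"
        using b by blast
      also have "?\<tau> ` (T - {b}) = T - {b}"
        using a by (force simp: transpose_def)
      finally show ?thesis
        by simp
    qed
    have "insert a (T - {b}) - S \<subset> T - S"
      using a b by auto
    then have "card (insert a (T - {b}) - S) < card (T - S)"
      using finT by (simp add: psubset_card_mono)
    moreover have "insert a (T - {b}) \<in> winning N v"
      using equi_desirable_transpose_winning[OF P(4)[OF i(1) a(2) i(2)] less.prems(1)] im by simp
    moreover have "card (insert a (T - {b}) \<inter> C ! j) \<le> card (S \<inter> C ! j)"
      if j: "j < length C" for j
    proof (cases "j = i")
      case True
      have "insert a (T - {b}) \<inter> C ! i = insert a (T \<inter> C ! i - {b})"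
        using a by blast
      moreover have "card (insert a (T \<inter> C ! i - {b})) = card (T \<inter> C ! i)"
        using a b i finT card_Suc_Diff1[of "T \<inter> C ! i" b] by simp
      ultimately show ?thesis
        using less.prems(2)[OF j] True by simp
    next
      case False
      then have "insert a (T - {b}) \<inter> C ! j = T \<inter> C ! j"
        using P(3)[OF i(1) j] a i by blast
      then show ?thesis
        using less.prems(2)[OF j] by simp
    qed
    ultimately show ?thesis
      by (rule less.hyps)
  qed
qed

lemma minimal_winning_vector_nth:
  assumes "minimal_winning_vectors N v C = {m}" and "T \<in> minimal_winning N v"
    and "i < length C"
  shows "card (T \<inter> C ! i) = m ! i"
proof -
  have "coalition_vector C T = m"
    using assms(1,2) unfolding minimal_winning_vectors_def by auto
  then show ?thesis
    using assms(3) unfolding coalition_vector_def by auto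
qed

lemma winning_iff_thresholds:
  assumes game: "simple_game N v" and C: "lists_classes N v C"
    and min: "minimal_winning_vectors N v C = {m}"
  shows "winning N v = {S. S \<subseteq> N \<and> (\<forall>i < length C. m ! i \<le> card (S \<inter> C ! i))}"
proof (intro equalityI subsetI)
  have fin: "finite N"
    using game unfolding simple_game_def by simp
  fix S assume S: "S \<in> winning N v"
  then have SN: "S \<subseteq> N"
    unfolding winning_def by simp
  obtain T where T: "T \<in> minimal_winning N v" "T \<subseteq> S"
    using minimal_winning_subset_exists[OF fin S] by blast
  have "m ! i \<le> card (S \<inter> C ! i)" if i: "i < length C" for i
  proof -
    have "card (T \<inter> C ! i) \<le> card (S \<inter> C ! i)"
      using T(2) finite_subset[OF SN fin] by (intro card_mono) auto
    then show ?thesis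
      using minimal_winning_vector_nth[OF min T(1) i] by simp
  qed
  then show "S \<in> {S. S \<subseteq> N \<and> (\<forall>i < length C. m ! i \<le> card (S \<inter> C ! i))}"
    using SN by blast
next
  fix S assume "S \<in> {S. S \<subseteq> N \<and> (\<forall>i < length C. m ! i \<le> card (S \<inter> C ! i))}"
  then have S: "S \<subseteq> N" "\<And>i. i < length C \<Longrightarrow> m ! i \<le> card (S \<inter> C ! i)"
    by auto
  obtain T where T: "T \<in> minimal_winning N v"
    using min unfolding minimal_winning_vectors_def by blast
  have "T \<in> winning N v"
    using T unfolding minimal_winning_def by simp
  then show "S \<in> winning N v"
    using winning_of_card_le[OF game C _ S(1)] S(2) minimal_winning_vector_nth[OF min T]
    by simp
qed

text \<open>A minimal winning coalition containing \<open>a\<close> has exactly \<open>m ! i\<close> players of the class of \<open>a\<close>,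
  one of them \<open>a\<close> itself; a winning coalition without \<open>a\<close> has at least \<open>m ! i\<close> of them, but not
  the whole class.\<close>

lemma threshold_bounds:
  assumes game: "simple_game N v" and C: "lists_classes N v C"
    and min: "minimal_winning_vectors N v C = {m}"
    and i: "i < length C" and a: "a \<in> C ! i"
  shows "\<not> null_player N v a \<Longrightarrow> 0 < m ! i"
    and "\<not> veto_player N v a \<Longrightarrow> m ! i < card (C ! i)"
proof -
  have fin: "finite N"
    using game unfolding simple_game_def by simp
  have CN: "C ! i \<subseteq> N"
    using lists_classes_partition(2)[OF C i] .
  have aN: "a \<in> N" and finC: "finite (C ! i)"
    using CN a fin by (auto intro: finite_subset)
  show "0 < m ! i" if null: "\<not> null_player N v a"
  proof -
    obtain S where S: "S \<in> minimal_winning N v" "a \<in> S"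
      using null aN unfolding null_player_def by blast
    then have "0 < card (S \<inter> C ! i)"
      using a finC by (auto simp: card_gt_0_iff)
    then show ?thesis
      using minimal_winning_vector_nth[OF min S(1) i] by simp
  qed
  show "m ! i < card (C ! i)" if veto: "\<not> veto_player N v a"
  proof -
    obtain S where S: "S \<in> winning N v" "a \<notin> S"
      using veto aN unfolding veto_player_def by blast
    have "m ! i \<le> card (S \<inter> C ! i)"
      using S(1) i winning_iff_thresholds[OF game C min] by blast
    also have "\<dots> < card (C ! i)"
      using S(2) a finC by (intro psubset_card_mono) auto
    finally show ?thesis .
  qed
qed

section \<open>The dimension of an intersection of threshold games on disjoint sets\<close>

lemma weighted_threshold_game:
  assumes "finite N" and "A \<subseteq> N" and "0 < m" and "m \<le> card A"
  shows "weighted_game N (\<lambda>S. if m \<le> card (S \<inter> A) then 1 else 0)"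
    (is "weighted_game N ?g")
proof -
  have card_mono': "card (S \<inter> A) \<le> card (T \<inter> A)" if "S \<subseteq> T" "T \<subseteq> N" for S T
    using that finite_subset[OF that(2) assms(1)] by (intro card_mono) auto
  have NA: "N \<inter> A = A"
    using assms(2) by blast
  have "?g S \<le> ?g T" if "S \<subseteq> T" "T \<subseteq> N" for S T
    using card_mono'[OF that] by auto
  moreover have "N \<noteq> {}"
    using assms by auto
  ultimately have game: "simple_game N ?g"
    using assms NA unfolding simple_game_def by auto
  have sum: "sum (\<lambda>x. if x \<in> A then 1 else 0) S = real (card (S \<inter> A))" if "S \<subseteq> N" for S
    using finite_subset[OF that assms(1)] by (simp add: sum.If_cases)
  show ?thesis
    unfolding weighted_game_def
  proof (intro conjI exI ballI)
    fix W assume "W \<in> winning N ?g"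
    then show "real m \<le> sum (\<lambda>x. if x \<in> A then 1 else 0) W"
      using sum[of W] unfolding winning_def by (auto split: if_splits)
  next
    fix L assume "L \<in> losing N ?g"
    then show "sum (\<lambda>x. if x \<in> A then 1 else 0) L < real m"
      using sum[of L] unfolding losing_def by (auto split: if_splits)
  qed (fact game)
qed

text \<open>The exchange preserves the sum of the weights of the two coalitions, which is below twice the
  quota before it and would be at least twice the quota after it.\<close>

lemma weighted_game_no_swap:
  assumes "weighted_game N g" and L: "L \<in> losing N g" and M: "M \<in> losing N g"
    and x: "x \<in> M" "x \<notin> L" and y: "y \<in> L" "y \<notin> M"
    and L': "insert x (L - {y}) \<in> winning N g" and M': "insert y (M - {x}) \<in> winning N g"
  shows False
proof -
  obtain w :: "'a \<Rightarrow> real" and q where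
    win: "\<And>S. S \<in> winning N g \<Longrightarrow> q \<le> sum w S" and
    lose: "\<And>S. S \<in> losing N g \<Longrightarrow> sum w S < q"
    using assms(1) unfolding weighted_game_def by auto
  have "finite N" "L \<subseteq> N" "M \<subseteq> N"
    using assms(1) L M unfolding weighted_game_def simple_game_def losing_def by auto
  then have fin: "finite L" "finite M"
    by (auto intro: finite_subset)
  have "sum w (insert x (L - {y})) = w x + (sum w L - w y)"
    using x y fin by (simp add: sum_diff1)
  moreover have "sum w (insert y (M - {x})) = w y + (sum w M - w x)"
    using x y fin by (simp add: sum_diff1)
  ultimately show False
    using win[OF L'] win[OF M'] lose[OF L] lose[OF M] by linarith
qed

text \<open>The coalitions \<open>L i\<close> of the proof contain everyone except that they fall one player short
  of the threshold in \<open>A i\<close>. If \<open>k < t\<close>, then by the pigeonhole principle one of the \<open>k\<close>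
  games rejects two of them, and a trade between these two contradicts its being weighted.\<close>

lemma intersection_of_weighted_thresholds_ge:
  assumes fin: "finite N"
    and sub: "\<And>i. i < t \<Longrightarrow> A i \<subseteq> N"
    and disj: "\<And>i j. \<lbrakk>i < t; j < t; i \<noteq> j\<rbrakk> \<Longrightarrow> A i \<inter> A j = {}"
    and pos: "\<And>i. i < t \<Longrightarrow> 0 < m i" and less: "\<And>i. i < t \<Longrightarrow> m i < card (A i)"
    and win: "winning N v = {S. S \<subseteq> N \<and> (\<forall>i<t. m i \<le> card (S \<inter> A i))}"
    and "intersection_of_weighted N v k"
  shows "t \<le> k"
proof (rule ccontr)
  assume "\<not> t \<le> k"
  obtain g where g: "\<And>h. h < k \<Longrightarrow> weighted_game N (g h)"
    and vg: "\<And>S. S \<subseteq> N \<Longrightarrow> S \<in> winning N v \<longleftrightarrow> (\<forall>h<k. S \<in> winning N (g h))"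
    using assms(7) unfolding intersection_of_weighted_def by blast
  have finA: "finite (A i)" if "i < t" for i
    using sub[OF that] fin by (rule finite_subset)
  have "\<exists>B. B \<subseteq> A i \<and> card B = m i - 1" if "i < t" for i
    using less[OF that] by (meson less_imp_diff_less less_imp_le obtain_subset_with_card_n)
  then obtain B where B: "\<And>i. i < t \<Longrightarrow> B i \<subseteq> A i" "\<And>i. i < t \<Longrightarrow> card (B i) = m i - 1"
    by metis
  define L where "L i = (N - A i) \<union> B i" for i
  have LN: "L i \<subseteq> N" if "i < t" for i
    using sub[OF that] B(1)[OF that] unfolding L_def by blast
  have LA: "L i \<inter> A i = B i" if "i < t" for i
    using B(1)[OF that] unfolding L_def by blast
  have LA': "A j \<subseteq> L i" if "i < t" "j < t" "i \<noteq> j" for i j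
    using sub[OF that(2)] disj[OF that] unfolding L_def by blast
  have "\<exists>h<k. L i \<notin> winning N (g h)" if "i < t" for i
  proof -
    have "L i \<notin> winning N v"
      using win LA[OF that] B(2)[OF that] pos[OF that] that by force
    then show ?thesis
      using vg[OF LN[OF that]] by blast
  qed
  then obtain f where f: "\<And>i. i < t \<Longrightarrow> f i < k" "\<And>i. i < t \<Longrightarrow> L i \<notin> winning N (g (f i))"
    by metis
  have "\<not> inj_on f {..<t}"
  proof
    assume "inj_on f {..<t}"
    then have "card {..<t} \<le> card {..<k}"
      by (rule card_inj_on_le) (use f in auto)
    then show False
      using \<open>\<not> t \<le> k\<close> by simp
  qed
  then obtain i j where ij: "i < t" "j < t" "i \<noteq> j" "f i = f j"
    unfolding inj_on_def by auto
  have missing: "\<exists>x \<in> A i. x \<notin> L i" if "i < t" for i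
  proof -
    have "B i \<noteq> A i"
      using B(2)[OF that] less[OF that] by auto
    then show ?thesis
      using LA[OF that] by blast
  qed
  obtain x where x: "x \<in> A i" "x \<notin> L i"
    using missing ij(1) by blast
  obtain y where y: "y \<in> A j" "y \<notin> L j"
    using missing ij(2) by blast
  \<comment> \<open>In \<open>A i\<close> the new member \<open>x\<close> makes up exactly for the missing player. From the other
    sets \<open>A h\<close>, of which \<open>L i\<close> contains everyone, only \<open>y\<close> is lost, and \<open>m h < card (A h)\<close> leaves
    room for that.\<close>
  have swap: "insert x (L i - {y}) \<in> winning N v"
    if ij: "i < t" "j < t" "i \<noteq> j" and x: "x \<in> A i" "x \<notin> L i" and y: "y \<in> A j" for i j x y
  proof -
    have "m h \<le> card (insert x (L i - {y}) \<inter> A h)" if h: "h < t" for h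
    proof (cases "h = i")
      case True
      have "insert x (L i - {y}) \<inter> A i = insert x (B i)"
        using LA[OF ij(1)] x y disj[OF ij] by blast
      moreover have "x \<notin> B i"
        using x LA[OF ij(1)] by blast
      moreover have "finite (B i)"
        using B(1)[OF ij(1)] finA[OF ij(1)] by (rule finite_subset)
      ultimately show ?thesis
        using True B(2)[OF ij(1)] pos[OF ij(1)] by simp
    next
      case False
      have "A h - {y} \<subseteq> insert x (L i - {y}) \<inter> A h"
        using LA'[OF ij(1) h] False by blast
      then have "card (A h - {y}) \<le> card (insert x (L i - {y}) \<inter> A h)"
        using finA[OF h] by (intro card_mono) auto
      moreover have "m h \<le> card (A h - {y})"
        using less[OF h] by (auto simp: card_Diff_singleton_if)
      ultimately show ?thesis
        by simp
    qed
    then show ?thesis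
      using win LN[OF ij(1)] x sub[OF ij(1)] by blast
  qed
  have in_g: "S \<in> winning N (g (f i))" if "S \<in> winning N v" for S
    using that vg[of S] f(1)[OF ij(1)] unfolding winning_def by blast
  show False
  proof (rule weighted_game_no_swap[OF g[OF f(1)[OF ij(1)]]])
    show "L i \<in> losing N (g (f i))" "L j \<in> losing N (g (f i))"
      using f(2)[OF ij(1)] f(2)[OF ij(2)] ij(4) LN[OF ij(1)] LN[OF ij(2)]
      unfolding winning_def losing_def by auto
    show "x \<in> L j" "y \<in> L i"
      using x y LA'[OF ij(1,2,3)] LA'[OF ij(2,1)] ij(3) by blast+
    show "x \<notin> L i" "y \<notin> L j"
      by fact+
    show "insert x (L i - {y}) \<in> winning N (g (f i))"
      using in_g swap[OF ij(1-3) x y(1)] by blast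
    show "insert y (L j - {x}) \<in> winning N (g (f i))"
      using in_g swap[OF ij(2,1) _ y x(1)] ij(3) by blast
  qed
qed

lemma dimension_thresholds:
  assumes fin: "finite N" and "0 < t"
    and sub: "\<And>i. i < t \<Longrightarrow> A i \<subseteq> N"
    and disj: "\<And>i j. \<lbrakk>i < t; j < t; i \<noteq> j\<rbrakk> \<Longrightarrow> A i \<inter> A j = {}"
    and pos: "\<And>i. i < t \<Longrightarrow> 0 < m i" and less: "\<And>i. i < t \<Longrightarrow> m i < card (A i)"
    and win: "winning N v = {S. S \<subseteq> N \<and> (\<forall>i<t. m i \<le> card (S \<inter> A i))}"
  shows "dimension N v = t"
  unfolding dimension_def
proof (rule Least_equality)
  let ?g = "\<lambda>i S. if m i \<le> card (S \<inter> A i) then 1 else 0"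
  have "weighted_game N (?g i)" if "i < t" for i
    using weighted_threshold_game[OF fin sub pos] less that by (simp add: less_imp_le)
  moreover have "S \<in> winning N v \<longleftrightarrow> (\<forall>i<t. S \<in> winning N (?g i))" if "S \<subseteq> N" for S
    unfolding win using that by (auto simp: winning_def)
  ultimately have "intersection_of_weighted N v t"
    unfolding intersection_of_weighted_def by (intro exI[of _ ?g]) blast
  then show "1 \<le> t \<and> intersection_of_weighted N v t"
    using \<open>0 < t\<close> by simp
next
  fix k assume "1 \<le> k \<and> intersection_of_weighted N v k"
  then have "intersection_of_weighted N v k"
    by simp
  then show "t \<le> k"
    using intersection_of_weighted_thresholds_ge[where A = A and m = m, OF fin sub disj pos less win]
    by simp
qed

theorem theorem4p1:
  fixes N :: "'a set" and v :: "'a set \<Rightarrow> nat" and t :: nat and n m :: "nat list"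
  assumes "length n = t" and "length m = t"
    and "\<forall>i<t. n ! i > 0"
    and "simple_game_with_minimum N v"
    and "characterizes n m N v"
    and "\<nexists>a. null_player N v a"
    and "\<nexists>a. veto_player N v a"
  shows "dimension N v = t"
proof -
  have game: "simple_game N v"
    using assms(4) unfolding simple_game_with_minimum_def by simp
  then have fin: "finite N" and "N \<noteq> {}"
    unfolding simple_game_def by auto
  obtain C where C: "lists_classes N v C" and card: "map card C = n"
    and min: "minimal_winning_vectors N v C = {m}"
    using assms(5) unfolding characterizes_def by blast
  have t: "length C = t"
    using card assms(1) by auto
  note P = lists_classes_partition[OF C, unfolded t]
  have "0 < t"
    using P(1) \<open>N \<noteq> {}\<close> t by (cases C) auto
  have bounds: "0 < m ! i \<and> m ! i < card (C ! i)" if "i < t" for i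
  proof -
    have "0 < card (C ! i)"
      using assms(3) that card t nth_map by metis
    then obtain a where "a \<in> C ! i"
      by fastforce
    then show ?thesis
      using threshold_bounds[OF game C min] that t assms(6,7) by blast
  qed
  show ?thesis
  proof (rule dimension_thresholds[where A = "nth C" and m = "nth m"])
    show "winning N v = {S. S \<subseteq> N \<and> (\<forall>i<t. m ! i \<le> card (S \<inter> C ! i))}"
      using winning_iff_thresholds[OF game C min] t by simp
  qed (use fin \<open>0 < t\<close> P(2,3) bounds in simp_all)
qed

end
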